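(* There exists $x\in JH_\infty$ with $\|x\|=1$ such that $$\inf_{\alpha>0}\operatorname{diam}S(B_{JH_\infty^*},x,\alpha)\leq\frac53.$$
   Context: All Banach spaces are real. For a Banach space $X$, $B_X$ is its closed unit ball and $X^*$ its topological dual; for $x\in X$, $\alpha>0$ and bounded $B\subseteq X^*$, the $w^*$-slice is $S(B,x,\alpha)=\{x^*\in B: x^*(x)>\sup_{y^*\in B}y^*(x)-\alpha\}$. The tree: $T=\{\emptyset\}\cup\{(\alpha_1,\ldots,\alpha_k): k\in\mathbb N,\ \alpha_1,\ldots,\alpha_k\in\mathbb N\}$ is the set of finite sequences of natural numbers, partially ordered by initial-segment extension, with $\emptyset$ the least element; $|(\alpha_1,\ldots,\alpha_k)|=k$ and $|\emptyset|=0$. A segment is a non-empty finite interval of $T$, i.e. a set $\{t\in T:s\le t\le s'\}$ with $s\le s'$; it is an $n$-$m$ segment if $|s|=n$ and $|s'|=m$. A finite family $\{S_1,\ldots,S_k\}$ of segments is admissible if there are $n\le m$ such that every $S_i$ is an $n$-$m$ segment and $S_i\cap S_j=\emptyset$ for $i\ne j$. $JH_\infty$ is the completion of the space of finitely nonzero functions $x:T\to\mathbb R$ under the norm $\|x\|=\sup\sum_{i=1}^k\left|\sum_{t\in S_i}x(t)\right|$, the supremum being over all admissible families $\{S_1,\ldots,S_k\}$ of segments of $T$. *)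

theory Defs
  imports "HOL-Analysis.Analysis" "HOL-Library.Sublist"
begin

section \<open>The completion of a real normed space\<close>

text \<open>Cauchy sequences modulo null sequences.\<close>

definition completion_rel :: "(nat \<Rightarrow> 'a::real_normed_vector) \<Rightarrow> (nat \<Rightarrow> 'a) \<Rightarrow> bool"
  where "completion_rel X Y \<longleftrightarrow> Cauchy X \<and> Cauchy Y \<and> (\<lambda>n. X n - Y n) \<longlonglongrightarrow> 0"

lemma completion_rel_refl: "Cauchy X \<Longrightarrow> completion_rel X X"
  by (simp add: completion_rel_def)

lemma part_equivp_completion_rel: "part_equivp completion_rel"
proof (rule part_equivpI)
  show "\<exists>X::nat \<Rightarrow> 'a. completion_rel X X"
    by (rule exI[of _ "\<lambda>_. 0"]) (simp add: completion_rel_def Cauchy_def)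
  show "symp (completion_rel :: (nat \<Rightarrow> 'a) \<Rightarrow> _)"
  proof (rule sympI)
    fix X Y :: "nat \<Rightarrow> 'a"
    assume "completion_rel X Y"
    then show "completion_rel Y X"
      unfolding completion_rel_def using tendsto_minus[of "\<lambda>n. X n - Y n" 0 sequentially] by simp
  qed
  show "transp (completion_rel :: (nat \<Rightarrow> 'a) \<Rightarrow> _)"
  proof (rule transpI)
    fix X Y Z :: "nat \<Rightarrow> 'a"
    assume "completion_rel X Y" "completion_rel Y Z"
    then show "completion_rel X Z"
      unfolding completion_rel_def
      using tendsto_add[of "\<lambda>n. X n - Y n" 0 sequentially "\<lambda>n. Y n - Z n" 0] by simp
  qed
qed

quotient_type (overloaded) 'a completion = "nat \<Rightarrow> 'a::real_normed_vector" / partial: completion_rel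
  by (rule part_equivp_completion_rel)

lemma Cauchy_norm_tendsto:
  fixes X :: "nat \<Rightarrow> 'a::real_normed_vector"
  assumes "Cauchy X"
  shows "(\<lambda>n. norm (X n)) \<longlonglongrightarrow> lim (\<lambda>n. norm (X n))"
proof -
  have "Cauchy (\<lambda>n. norm (X n))"
  proof (rule CauchyI)
    fix e :: real
    assume "0 < e"
    then obtain M where M: "\<forall>m\<ge>M. \<forall>n\<ge>M. norm (X m - X n) < e"
      using CauchyD[OF assms] by blast
    have "norm (norm (X m) - norm (X n)) < e" if "m \<ge> M" "n \<ge> M" for m n
      using M that norm_triangle_ineq3[of "X m" "X n"] by (metis le_less_trans real_norm_def)
    then show "\<exists>M. \<forall>m\<ge>M. \<forall>n\<ge>M. norm (norm (X m) - norm (X n)) < e"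
      by blast
  qed
  then show ?thesis
    by (simp add: Cauchy_convergent_iff convergent_LIMSEQ_iff)
qed

lemma Cauchy_add_seq:
  fixes X Y :: "nat \<Rightarrow> 'a::real_normed_vector"
  assumes "Cauchy X" "Cauchy Y"
  shows "Cauchy (\<lambda>n. X n + Y n)"
proof (rule CauchyI)
  fix e :: real
  assume "0 < e"
  then obtain M N where M: "\<forall>m\<ge>M. \<forall>n\<ge>M. norm (X m - X n) < e/2"
    and N: "\<forall>m\<ge>N. \<forall>n\<ge>N. norm (Y m - Y n) < e/2"
    using CauchyD[OF assms(1), of "e/2"] CauchyD[OF assms(2), of "e/2"] by auto
  have "norm ((X m + Y m) - (X n + Y n)) < e" if "m \<ge> max M N" "n \<ge> max M N" for m n
    using M[rule_format, of m n] N[rule_format, of m n] that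
      norm_diff_triangle_ineq[of "X m" "Y m" "X n" "Y n"] by simp
  then show "\<exists>M. \<forall>m\<ge>M. \<forall>n\<ge>M. norm ((X m + Y m) - (X n + Y n)) < e"
    by blast
qed

lemma Cauchy_scaleR_seq:
  fixes X :: "nat \<Rightarrow> 'a::real_normed_vector"
  shows "Cauchy X \<Longrightarrow> Cauchy (\<lambda>n. c *\<^sub>R X n)"
  by (rule bounded_linear.Cauchy[OF bounded_linear_scaleR_right])

lemma Cauchy_minus_seq:
  fixes X :: "nat \<Rightarrow> 'a::real_normed_vector"
  shows "Cauchy X \<Longrightarrow> Cauchy (\<lambda>n. - X n)"
  by (rule bounded_linear.Cauchy[OF bounded_linear_minus[OF bounded_linear_ident]])

lemma Cauchy_diff_seq:
  fixes X Y :: "nat \<Rightarrow> 'a::real_normed_vector"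
  shows "Cauchy X \<Longrightarrow> Cauchy Y \<Longrightarrow> Cauchy (\<lambda>n. X n - Y n)"
  using Cauchy_add_seq[OF _ Cauchy_minus_seq, of X Y] by simp

instantiation completion :: (real_normed_vector) real_normed_vector
begin

lift_definition zero_completion :: "'a completion" is "\<lambda>_. 0"
  by (simp add: completion_rel_def Cauchy_def)

lift_definition plus_completion :: "'a completion \<Rightarrow> 'a completion \<Rightarrow> 'a completion"
  is "\<lambda>X Y n. X n + Y n"
proof -
  fix X X' Y Y' :: "nat \<Rightarrow> 'a"
  assume "completion_rel X X'" "completion_rel Y Y'"
  then show "completion_rel (\<lambda>n. X n + Y n) (\<lambda>n. X' n + Y' n)"
    unfolding completion_rel_def
    using tendsto_add[of "\<lambda>n. X n - X' n" 0 sequentially "\<lambda>n. Y n - Y' n" 0]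
    by (simp add: Cauchy_add_seq algebra_simps)
qed

lift_definition uminus_completion :: "'a completion \<Rightarrow> 'a completion" is "\<lambda>X n. - X n"
proof -
  fix X Y :: "nat \<Rightarrow> 'a"
  assume "completion_rel X Y"
  then show "completion_rel (\<lambda>n. - X n) (\<lambda>n. - Y n)"
    unfolding completion_rel_def
    using tendsto_minus[of "\<lambda>n. X n - Y n" 0 sequentially]
    by (simp add: Cauchy_minus_seq)
qed

lift_definition minus_completion :: "'a completion \<Rightarrow> 'a completion \<Rightarrow> 'a completion"
  is "\<lambda>X Y n. X n - Y n"
proof -
  fix X X' Y Y' :: "nat \<Rightarrow> 'a"
  assume "completion_rel X X'" "completion_rel Y Y'"
  then show "completion_rel (\<lambda>n. X n - Y n) (\<lambda>n. X' n - Y' n)"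
    unfolding completion_rel_def
    using tendsto_diff[of "\<lambda>n. X n - X' n" 0 sequentially "\<lambda>n. Y n - Y' n" 0]
    by (simp add: Cauchy_diff_seq algebra_simps)
qed

lift_definition scaleR_completion :: "real \<Rightarrow> 'a completion \<Rightarrow> 'a completion"
  is "\<lambda>c X n. c *\<^sub>R X n"
proof -
  fix c :: real and X Y :: "nat \<Rightarrow> 'a"
  assume "completion_rel X Y"
  then show "completion_rel (\<lambda>n. c *\<^sub>R X n) (\<lambda>n. c *\<^sub>R Y n)"
    unfolding completion_rel_def
    using tendsto_scaleR[of "\<lambda>_. c" c sequentially "\<lambda>n. X n - Y n" 0]
    by (simp add: Cauchy_scaleR_seq scaleR_diff_right)
qed

lift_definition norm_completion :: "'a completion \<Rightarrow> real" is "\<lambda>X. lim (\<lambda>n. norm (X n))"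
proof -
  fix X Y :: "nat \<Rightarrow> 'a"
  assume XY: "completion_rel X Y"
  then have X: "Cauchy X" and Y: "Cauchy Y" and 0: "(\<lambda>n. X n - Y n) \<longlonglongrightarrow> 0"
    by (auto simp: completion_rel_def)
  have "(\<lambda>n. norm (X n) - norm (Y n)) \<longlonglongrightarrow> 0"
    by (rule Lim_null_comparison[OF _ tendsto_norm_zero[OF 0]])
      (simp add: norm_triangle_ineq3)
  moreover have "(\<lambda>n. norm (X n) - norm (Y n)) \<longlonglongrightarrow> lim (\<lambda>n. norm (X n)) - lim (\<lambda>n. norm (Y n))"
    by (intro tendsto_diff Cauchy_norm_tendsto X Y)
  ultimately show "lim (\<lambda>n. norm (X n)) = lim (\<lambda>n. norm (Y n))"
    using LIMSEQ_unique by fastforce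
qed

definition dist_completion :: "'a completion \<Rightarrow> 'a completion \<Rightarrow> real"
  where "dist_completion x y = norm (x - y)"

definition sgn_completion :: "'a completion \<Rightarrow> 'a completion"
  where "sgn_completion x = inverse (norm x) *\<^sub>R x"

definition uniformity_completion :: "('a completion \<times> 'a completion) filter"
  where "uniformity_completion = (INF e\<in>{0 <..}. principal {(x, y). dist x y < e})"

definition open_completion :: "'a completion set \<Rightarrow> bool"
  where "open_completion U \<longleftrightarrow> (\<forall>x\<in>U. eventually (\<lambda>(x', y). x' = x \<longrightarrow> y \<in> U) uniformity)"

instance
proof
  fix x y z :: "'a completion" and a b :: real and U :: "'a completion set"
  show "x + y + z = x + (y + z)"
    by transfer (simp add: completion_rel_refl Cauchy_add_seq completion_rel_def add.assoc)
  show "x + y = y + x"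
    by transfer (simp add: Cauchy_add_seq completion_rel_def)
  show "0 + x = x"
    by transfer (simp add: completion_rel_def)
  show "- x + x = 0"
    by transfer (simp add: completion_rel_def Cauchy_def)
  show "x - y = x + - y"
    by transfer (simp add: completion_rel_def Cauchy_diff_seq)
  show "a *\<^sub>R (x + y) = a *\<^sub>R x + a *\<^sub>R y"
    by transfer (simp add: completion_rel_def Cauchy_add_seq Cauchy_scaleR_seq scaleR_add_right)
  show "(a + b) *\<^sub>R x = a *\<^sub>R x + b *\<^sub>R x"
    by transfer (simp add: completion_rel_def Cauchy_add_seq Cauchy_scaleR_seq scaleR_add_left)
  show "a *\<^sub>R b *\<^sub>R x = (a * b) *\<^sub>R x"
    by transfer (simp add: completion_rel_def Cauchy_scaleR_seq)
  show "1 *\<^sub>R x = x"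
    by transfer (simp add: completion_rel_def)
  show "dist x y = norm (x - y)"
    by (rule dist_completion_def)
  show "sgn x = inverse (norm x) *\<^sub>R x"
    by (rule sgn_completion_def)
  show "uniformity = (INF e\<in>{0 <..}. principal {(x, y :: 'a completion). dist x y < e})"
    by (rule uniformity_completion_def)
  show "open U \<longleftrightarrow> (\<forall>x\<in>U. eventually (\<lambda>(x', y). x' = x \<longrightarrow> y \<in> U) uniformity)"
    by (rule open_completion_def)
  show "norm x = 0 \<longleftrightarrow> x = 0"
  proof transfer
    fix X :: "nat \<Rightarrow> 'a"
    assume "completion_rel X X"
    then have X: "Cauchy X"
      by (simp add: completion_rel_def)
    have "lim (\<lambda>n. norm (X n)) = 0 \<longleftrightarrow> (\<lambda>n. norm (X n)) \<longlonglongrightarrow> 0"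
      using Cauchy_norm_tendsto[OF X] limI by metis
    also have "\<dots> \<longleftrightarrow> X \<longlonglongrightarrow> 0"
      by (rule tendsto_norm_zero_iff)
    finally show "lim (\<lambda>n. norm (X n)) = 0 \<longleftrightarrow> completion_rel X (\<lambda>_. 0)"
      using X by (simp add: completion_rel_def Cauchy_def)
  qed
  show "norm (x + y) \<le> norm x + norm y"
  proof transfer
    fix X Y :: "nat \<Rightarrow> 'a"
    assume "completion_rel X X" "completion_rel Y Y"
    then have X: "Cauchy X" and Y: "Cauchy Y"
      by (auto simp: completion_rel_def)
    show "lim (\<lambda>n. norm (X n + Y n)) \<le> lim (\<lambda>n. norm (X n)) + lim (\<lambda>n. norm (Y n))"
      by (rule LIMSEQ_le[OF Cauchy_norm_tendsto[OF Cauchy_add_seq[OF X Y]]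
            tendsto_add[OF Cauchy_norm_tendsto[OF X] Cauchy_norm_tendsto[OF Y]]])
        (simp add: norm_triangle_ineq)
  qed
  show "norm (a *\<^sub>R x) = \<bar>a\<bar> * norm x"
  proof transfer
    fix c :: real and X :: "nat \<Rightarrow> 'a"
    assume "completion_rel X X"
    then have "Cauchy X"
      by (simp add: completion_rel_def)
    from tendsto_mult_left[OF Cauchy_norm_tendsto[OF this], of "\<bar>c\<bar>"]
    show "lim (\<lambda>n. norm (c *\<^sub>R X n)) = \<bar>c\<bar> * lim (\<lambda>n. norm (X n))"
      by (simp add: limI)
  qed
qed

end

lift_definition to_completion :: "'a::real_normed_vector \<Rightarrow> 'a completion" is "\<lambda>x _. x"
  by (simp add: completion_rel_def Cauchy_def)

lemma norm_to_completion [simp]: "norm (to_completion x) = norm x"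
  by transfer simp

lemma linear_to_completion: "linear to_completion"
proof (rule linearI)
  fix x y :: 'a and c :: real
  show "to_completion (x + y) = to_completion x + to_completion y"
    by transfer (simp add: completion_rel_def Cauchy_def)
  show "to_completion (c *\<^sub>R x) = c *\<^sub>R to_completion x"
    by transfer (simp add: completion_rel_def Cauchy_def)
qed

lemma to_completion_tendsto:
  assumes "Cauchy X"
  shows "(\<lambda>n. to_completion (X n)) \<longlonglongrightarrow> abs_completion X"
proof (rule LIMSEQ_I)
  have norm_eq: "norm (to_completion y - abs_completion X) = lim (\<lambda>n. norm (y - X n))" for y
  proof -
    have c: "Cauchy (\<lambda>_. y)"
      by (simp add: Cauchy_def)
    have "to_completion y - abs_completion X = abs_completion (\<lambda>n. y - X n)"
      using assms c
      by (simp add: to_completion.abs_eq minus_completion.abs_eq completion_rel_refl)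
    then show ?thesis
      using assms c
      by (simp add: norm_completion.abs_eq completion_rel_refl Cauchy_diff_seq)
  qed
  fix e :: real
  assume e: "0 < e"
  obtain M where M: "\<forall>m\<ge>M. \<forall>n\<ge>M. norm (X m - X n) < e/2"
    using CauchyD[OF assms, of "e/2"] e by auto
  have "norm (to_completion (X m) - abs_completion X) < e" if "m \<ge> M" for m
  proof -
    have "Cauchy (\<lambda>n. X m - X n)"
      by (intro Cauchy_diff_seq assms) (simp add: Cauchy_def)
    then have "lim (\<lambda>n. norm (X m - X n)) \<le> e/2"
      using M that by (intro LIMSEQ_le_const2[OF Cauchy_norm_tendsto])
        (auto intro!: exI[of _ M] less_imp_le)
    then show ?thesis
      using e by (simp add: norm_eq)
  qed
  then show "\<exists>M. \<forall>m\<ge>M. norm (to_completion (X m) - abs_completion X) < e"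
    by blast
qed

lemma to_completion_approx:
  fixes x :: "'a::real_normed_vector completion"
  assumes "e > 0"
  shows "\<exists>y. dist (to_completion y) x < e"
proof -
  obtain X where "completion_rel X X" "x = abs_completion X"
    by (induction x rule: completion.abs_induct) blast
  then have "(\<lambda>n. to_completion (X n)) \<longlonglongrightarrow> x"
    using to_completion_tendsto by (auto simp: completion_rel_def)
  then show ?thesis
    using assms by (meson LIMSEQ_iff_nz lim_sequentially order_refl)
qed

lemma closure_range_to_completion: "closure (range to_completion) = UNIV"
  using to_completion_approx by (force simp: closure_approachable)

instance completion :: (real_normed_vector) banach
proof
  fix Y :: "nat \<Rightarrow> 'a completion"
  assume Y: "Cauchy Y"
  obtain x where x: "\<And>n. dist (to_completion (x n)) (Y n) < inverse (real (Suc n))"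
    using to_completion_approx[of "inverse (real (Suc n))" "Y n" for n] by (metis inverse_positive_iff_positive of_nat_0_less_iff zero_less_Suc)
  have lim0: "(\<lambda>n. to_completion (x n) - Y n) \<longlonglongrightarrow> 0"
    by (rule Lim_null_comparison[OF always_eventually LIMSEQ_inverse_real_of_nat])
      (use x in \<open>simp add: dist_norm less_imp_le\<close>)
  have "Cauchy (\<lambda>n. (to_completion (x n) - Y n) + Y n)"
    by (intro Cauchy_add_seq Y LIMSEQ_imp_Cauchy[OF lim0])
  then have "Cauchy (\<lambda>n. to_completion (x n))"
    by simp
  then have "Cauchy x"
    unfolding Cauchy_def dist_norm
    by (simp flip: linear_diff[OF linear_to_completion])
  then have "(\<lambda>n. to_completion (x n)) \<longlonglongrightarrow> abs_completion x"
    by (rule to_completion_tendsto)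
  from tendsto_diff[OF this lim0] show "convergent Y"
    by (auto simp: convergent_def)
qed

section \<open>Segments of the tree and the space \<open>JH\<^sub>\<infinity>\<close>\<close>

text \<open>The tree \<open>T\<close> is the type \<^typ>\<open>nat list\<close>, ordered by \<^const>\<open>prefix\<close>, with level function
  \<^const>\<open>length\<close>.\<close>

definition nm_segment :: "nat \<Rightarrow> nat \<Rightarrow> nat list set \<Rightarrow> bool"
  where "nm_segment n m S \<longleftrightarrow>
    (\<exists>s s'. prefix s s' \<and> length s = n \<and> length s' = m \<and> S = {t. prefix s t \<and> prefix t s'})"

definition admissible :: "nat list set set \<Rightarrow> bool"
  where "admissible \<S> \<longleftrightarrow> finite \<S> \<and> \<S> \<noteq> {} \<and>
    (\<exists>n m. n \<le> m \<and> (\<forall>S\<in>\<S>. nm_segment n m S)) \<and> pairwise disjnt \<S>"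

text \<open>The finitely nonzero functions on \<open>T\<close>. The real supremum in their norm below is proper:
  the sums are bounded by the \<open>\<ell>\<^sub>1\<close>-norm, see \<open>jh_bdd_above\<close>.\<close>

typedef jh_fin = "{x :: nat list \<Rightarrow> real. finite {t. x t \<noteq> 0}}"
  by (rule exI[of _ "\<lambda>_. 0"]) simp

setup_lifting type_definition_jh_fin

lemma finite_segment: "nm_segment n m S \<Longrightarrow> finite S"
proof -
  have "{t. prefix s t \<and> prefix t s'} \<subseteq> set (prefixes s')" for s s' :: "nat list"
    by auto
  then show "nm_segment n m S \<Longrightarrow> finite S"
    unfolding nm_segment_def by (metis finite_set finite_subset)
qed

lemma admissible_singleton: "admissible {{t}}"
proof -
  have "nm_segment (length t) (length t) {t}"
    unfolding nm_segment_def by (rule exI[of _ t], rule exI[of _ t]) (auto simp: prefix_order.antisym)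
  then show ?thesis
    by (auto simp: admissible_def)
qed

lemma admissible_sum_le:
  assumes "admissible \<S>" and fin: "finite {t. x t \<noteq> 0}"
  shows "(\<Sum>S\<in>\<S>. \<bar>\<Sum>t\<in>S. x t\<bar>) \<le> (\<Sum>t | x t \<noteq> 0. \<bar>x t :: real\<bar>)"
proof -
  have fS: "finite \<S>" and fin_S: "\<forall>S\<in>\<S>. finite S" and "pairwise disjnt \<S>"
    using assms(1) finite_segment by (auto simp: admissible_def)
  then have disj: "\<forall>A\<in>\<S>. \<forall>B\<in>\<S>. A \<noteq> B \<longrightarrow> A \<inter> B = {}"
    by (auto simp: pairwise_def disjnt_def)
  have "(\<Sum>S\<in>\<S>. \<bar>\<Sum>t\<in>S. x t\<bar>) \<le> (\<Sum>S\<in>\<S>. \<Sum>t\<in>S. \<bar>x t\<bar>)"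
    by (intro sum_mono sum_abs)
  also have "\<dots> = (\<Sum>t\<in>\<Union>\<S>. \<bar>x t\<bar>)"
    using sum.Union_disjoint[OF fin_S disj, of "\<lambda>t. \<bar>x t\<bar>"] by simp
  also have "\<dots> = (\<Sum>t\<in>\<Union>\<S> \<inter> {t. x t \<noteq> 0}. \<bar>x t\<bar>)"
    using fS fin_S by (intro sum.mono_neutral_right) auto
  also have "\<dots> \<le> (\<Sum>t | x t \<noteq> 0. \<bar>x t\<bar>)"
    by (rule sum_mono2) (use fin in auto)
  finally show ?thesis .
qed

instantiation jh_fin :: real_normed_vector
begin

lift_definition zero_jh_fin :: jh_fin is "\<lambda>_. 0"
  by simp

lift_definition plus_jh_fin :: "jh_fin \<Rightarrow> jh_fin \<Rightarrow> jh_fin" is "\<lambda>x y t. x t + y t"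
proof -
  fix x y :: "nat list \<Rightarrow> real"
  assume "finite {t. x t \<noteq> 0}" "finite {t. y t \<noteq> 0}"
  then have "finite ({t. x t \<noteq> 0} \<union> {t. y t \<noteq> 0})"
    by simp
  then show "finite {t. x t + y t \<noteq> 0}"
    by (rule rev_finite_subset) auto
qed

lift_definition uminus_jh_fin :: "jh_fin \<Rightarrow> jh_fin" is "\<lambda>x t. - x t"
  by simp

lift_definition minus_jh_fin :: "jh_fin \<Rightarrow> jh_fin \<Rightarrow> jh_fin" is "\<lambda>x y t. x t - y t"
proof -
  fix x y :: "nat list \<Rightarrow> real"
  assume "finite {t. x t \<noteq> 0}" "finite {t. y t \<noteq> 0}"
  then have "finite ({t. x t \<noteq> 0} \<union> {t. y t \<noteq> 0})"
    by simp
  then show "finite {t. x t - y t \<noteq> 0}"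
    by (rule rev_finite_subset) auto
qed

lift_definition scaleR_jh_fin :: "real \<Rightarrow> jh_fin \<Rightarrow> jh_fin" is "\<lambda>c x t. c * x t"
  by (erule rev_finite_subset) auto

lift_definition norm_jh_fin :: "jh_fin \<Rightarrow> real"
  is "\<lambda>x. SUP \<S>\<in>{\<S>. admissible \<S>}. \<Sum>S\<in>\<S>. \<bar>\<Sum>t\<in>S. x t\<bar>" .

definition dist_jh_fin :: "jh_fin \<Rightarrow> jh_fin \<Rightarrow> real"
  where "dist_jh_fin x y = norm (x - y)"

definition sgn_jh_fin :: "jh_fin \<Rightarrow> jh_fin"
  where "sgn_jh_fin x = inverse (norm x) *\<^sub>R x"

definition uniformity_jh_fin :: "(jh_fin \<times> jh_fin) filter"
  where "uniformity_jh_fin = (INF e\<in>{0 <..}. principal {(x, y). dist x y < e})"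

definition open_jh_fin :: "jh_fin set \<Rightarrow> bool"
  where "open_jh_fin U \<longleftrightarrow> (\<forall>x\<in>U. eventually (\<lambda>(x', y). x' = x \<longrightarrow> y \<in> U) uniformity)"

lemma jh_bdd_above:
  assumes "finite {t. x t \<noteq> (0::real)}"
  shows "bdd_above ((\<lambda>\<S>. \<Sum>S\<in>\<S>. \<bar>\<Sum>t\<in>S. x t\<bar>) ` {\<S>. admissible \<S>})"
  using admissible_sum_le[OF _ assms] by (intro bdd_aboveI2) auto

instance
proof
  fix x y z :: jh_fin and a b :: real and U :: "jh_fin set"
  show "x + y + z = x + (y + z)"
    by transfer (simp add: add.assoc)
  show "x + y = y + x"
    by transfer (simp add: add.commute)
  show "0 + x = x"
    by transfer simp
  show "- x + x = 0"
    by transfer simp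
  show "x - y = x + - y"
    by transfer simp
  show "a *\<^sub>R (x + y) = a *\<^sub>R x + a *\<^sub>R y"
    by transfer (simp add: algebra_simps)
  show "(a + b) *\<^sub>R x = a *\<^sub>R x + b *\<^sub>R x"
    by transfer (simp add: algebra_simps)
  show "a *\<^sub>R b *\<^sub>R x = (a * b) *\<^sub>R x"
    by transfer (simp add: algebra_simps)
  show "1 *\<^sub>R x = x"
    by transfer simp
  show "dist x y = norm (x - y)"
    by (rule dist_jh_fin_def)
  show "sgn x = inverse (norm x) *\<^sub>R x"
    by (rule sgn_jh_fin_def)
  show "uniformity = (INF e\<in>{0 <..}. principal {(x, y :: jh_fin). dist x y < e})"
    by (rule uniformity_jh_fin_def)
  show "open U \<longleftrightarrow> (\<forall>x\<in>U. eventually (\<lambda>(x', y). x' = x \<longrightarrow> y \<in> U) uniformity)"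
    by (rule open_jh_fin_def)
  show "norm x = 0 \<longleftrightarrow> x = 0"
  proof transfer
    fix x :: "nat list \<Rightarrow> real"
    assume fin: "finite {t. x t \<noteq> 0}"
    have le: "\<bar>x t\<bar> \<le> (SUP \<S>\<in>{\<S>. admissible \<S>}. \<Sum>S\<in>\<S>. \<bar>\<Sum>t\<in>S. x t\<bar>)" for t
      using cSUP_upper[OF _ jh_bdd_above[OF fin], of "{{t}}"] admissible_singleton by simp
    have ne: "{\<S>. admissible \<S>} \<noteq> {}"
      using admissible_singleton by blast
    show "(SUP \<S>\<in>{\<S>. admissible \<S>}. \<Sum>S\<in>\<S>. \<bar>\<Sum>t\<in>S. x t\<bar>) = 0 \<longleftrightarrow> x = (\<lambda>_. 0)"
    proof
      assume "(SUP \<S>\<in>{\<S>. admissible \<S>}. \<Sum>S\<in>\<S>. \<bar>\<Sum>t\<in>S. x t\<bar>) = 0"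
      with le show "x = (\<lambda>_. 0)"
        by (intro ext) (metis abs_le_zero_iff)
    qed (use ne in simp)
  qed
  show "norm (x + y) \<le> norm x + norm y"
  proof transfer
    fix x y :: "nat list \<Rightarrow> real"
    assume x: "finite {t. x t \<noteq> 0}" and y: "finite {t. y t \<noteq> 0}"
    show "(SUP \<S>\<in>{\<S>. admissible \<S>}. \<Sum>S\<in>\<S>. \<bar>\<Sum>t\<in>S. x t + y t\<bar>)
      \<le> (SUP \<S>\<in>{\<S>. admissible \<S>}. \<Sum>S\<in>\<S>. \<bar>\<Sum>t\<in>S. x t\<bar>)
        + (SUP \<S>\<in>{\<S>. admissible \<S>}. \<Sum>S\<in>\<S>. \<bar>\<Sum>t\<in>S. y t\<bar>)"
    proof (rule cSUP_least)
      show "{\<S>. admissible \<S>} \<noteq> {}"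
        using admissible_singleton by blast
      fix \<S>
      assume \<S>: "\<S> \<in> {\<S>. admissible \<S>}"
      have "(\<Sum>S\<in>\<S>. \<bar>\<Sum>t\<in>S. x t + y t\<bar>) \<le> (\<Sum>S\<in>\<S>. \<bar>\<Sum>t\<in>S. x t\<bar> + \<bar>\<Sum>t\<in>S. y t\<bar>)"
        by (intro sum_mono) (simp add: sum.distrib abs_triangle_ineq)
      also have "\<dots> = (\<Sum>S\<in>\<S>. \<bar>\<Sum>t\<in>S. x t\<bar>) + (\<Sum>S\<in>\<S>. \<bar>\<Sum>t\<in>S. y t\<bar>)"
        by (rule sum.distrib)
      also have "\<dots> \<le> (SUP \<S>\<in>{\<S>. admissible \<S>}. \<Sum>S\<in>\<S>. \<bar>\<Sum>t\<in>S. x t\<bar>)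
        + (SUP \<S>\<in>{\<S>. admissible \<S>}. \<Sum>S\<in>\<S>. \<bar>\<Sum>t\<in>S. y t\<bar>)"
        by (intro add_mono cSUP_upper[OF \<S>] jh_bdd_above x y)
      finally show "(\<Sum>S\<in>\<S>. \<bar>\<Sum>t\<in>S. x t + y t\<bar>)
        \<le> (SUP \<S>\<in>{\<S>. admissible \<S>}. \<Sum>S\<in>\<S>. \<bar>\<Sum>t\<in>S. x t\<bar>)
          + (SUP \<S>\<in>{\<S>. admissible \<S>}. \<Sum>S\<in>\<S>. \<bar>\<Sum>t\<in>S. y t\<bar>)" .
    qed
  qed
  show "norm (a *\<^sub>R x) = \<bar>a\<bar> * norm x"
  proof transfer
    fix c :: real and x :: "nat list \<Rightarrow> real"
    assume x: "finite {t. x t \<noteq> 0}"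
    have ne: "{\<S>. admissible \<S>} \<noteq> {}"
      using admissible_singleton by blast
    have cont: "continuous (at_left r) ((*) \<bar>c\<bar>)" for r
      by (intro continuous_intros)
    have "\<bar>c\<bar> * (SUP \<S>\<in>{\<S>. admissible \<S>}. \<Sum>S\<in>\<S>. \<bar>\<Sum>t\<in>S. x t\<bar>)
      = (SUP \<S>\<in>{\<S>. admissible \<S>}. \<bar>c\<bar> * (\<Sum>S\<in>\<S>. \<bar>\<Sum>t\<in>S. x t\<bar>))"
      using continuous_at_Sup_mono[of "\<lambda>r. \<bar>c\<bar> * r"
          "(\<lambda>\<S>. \<Sum>S\<in>\<S>. \<bar>\<Sum>t\<in>S. x t\<bar>) ` {\<S>. admissible \<S>}"]
        jh_bdd_above[OF x] ne cont
      by (simp add: mono_def mult_left_mono image_image)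
    then show "(SUP \<S>\<in>{\<S>. admissible \<S>}. \<Sum>S\<in>\<S>. \<bar>\<Sum>t\<in>S. c * x t\<bar>)
      = \<bar>c\<bar> * (SUP \<S>\<in>{\<S>. admissible \<S>}. \<Sum>S\<in>\<S>. \<bar>\<Sum>t\<in>S. x t\<bar>)"
      by (simp add: abs_mult flip: sum_distrib_left)
  qed
qed

end

type_synonym JH_infty = "jh_fin completion"

text \<open>Meaningful for bounded \<open>B\<close> only, where the real supremum is proper.\<close>

definition wstar_slice ::
  "('a::real_normed_vector \<Rightarrow>\<^sub>L real) set \<Rightarrow> 'a \<Rightarrow> real \<Rightarrow> ('a \<Rightarrow>\<^sub>L real) set"
  where "wstar_slice B x \<alpha> =
    {f \<in> B. blinfun_apply f x > (SUP g\<in>B. blinfun_apply g x) - \<alpha>}"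

end

theory Submission
  imports Defs
begin

text \<open>Let \<open>e\<close> be the unit vector at the root. An admissible family with a member through the root
  consists of a single initial segment, so for \<open>\<parallel>y\<parallel> \<le> 1\<close> the sum \<open>\<parallel>e + y\<parallel> + \<parallel>e - y\<parallel>\<close> is governed by
  differences \<open>y(S) - y(S')\<close> over two initial segments. Since \<open>T\<close> branches infinitely,
  \<open>S\<close> and \<open>S'\<close> can be prolonged outside the support of \<open>y\<close> to a common level; beyond the
  branching point they then form an admissible pair, so the difference is at most \<open>\<parallel>y\<parallel>\<close>. Hence
  \<open>\<parallel>e + y\<parallel> + \<parallel>e - y\<parallel> \<le> 3\<close>, and the slice at \<open>e\<close> of width \<open>\<alpha>\<close> has diameter at most \<open>1 + 2\<alpha>\<close>.\<close>

section \<open>Diameters of slices\<close>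

text \<open>For \<open>h\<close>, \<open>k\<close> in the slice, add
  \<open>h (x + y) \<le> norm (x + y)\<close> and \<open>k (x - y) \<le> norm (x - y)\<close>. As
  \<open>h x\<close> and \<open>k x\<close> exceed \<open>1 - \<alpha>\<close>, this leaves
  \<open>(h - k) y < d + 2 * \<alpha>\<close>. The functional \<open>g\<close> forces the supremum
  in the slice to be at least 1.\<close>

lemma diameter_wstar_slice_le:
  fixes x :: "'a::real_normed_vector" and g :: "'a \<Rightarrow>\<^sub>L real"
  assumes bound: "\<And>y. norm y \<le> 1 \<Longrightarrow> norm (x + y) + norm (x - y) \<le> 2 + d"
    and g: "norm g \<le> 1" "blinfun_apply g x = 1"
    and d: "0 \<le> d" and \<alpha>: "0 \<le> \<alpha>"
  shows "diameter (wstar_slice (cball 0 1) x \<alpha>) \<le> d + 2 * \<alpha>"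
proof (rule diameter_le)
  have le: "blinfun_apply h y \<le> norm y" if "norm h \<le> 1" for h :: "'a \<Rightarrow>\<^sub>L real" and y
  proof -
    have "norm (blinfun_apply h y) \<le> norm h * norm y"
      by (rule norm_blinfun)
    also have "\<dots> \<le> norm y"
      using that by (simp add: mult_left_le_one_le)
    finally show ?thesis
      by simp
  qed
  have "bdd_above ((\<lambda>h. blinfun_apply h x) ` cball (0 :: 'a \<Rightarrow>\<^sub>L real) 1)"
    by (intro bdd_aboveI2[where M="norm x"] le) simp
  then have "1 \<le> (SUP h\<in>cball (0 :: 'a \<Rightarrow>\<^sub>L real) 1. blinfun_apply h x)"
    using cSUP_upper[of g "cball 0 1" "\<lambda>h. blinfun_apply h x"] g by simp
  then have slice: "norm h \<le> 1 \<and> 1 - \<alpha> < blinfun_apply h x"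
    if "h \<in> wstar_slice (cball 0 1) x \<alpha>" for h
    using that by (auto simp: wstar_slice_def)
  show "wstar_slice (cball 0 1) x \<alpha> \<noteq> {} \<or> 0 \<le> d + 2 * \<alpha>"
    using d \<alpha> by simp
  fix h k
  assume h: "h \<in> wstar_slice (cball 0 1) x \<alpha>" and k: "k \<in> wstar_slice (cball 0 1) x \<alpha>"
  have unit: "blinfun_apply (h - k) y \<le> d + 2 * \<alpha>" if "norm y \<le> 1" for y
    using le[of h "x + y"] le[of k "x - y"] slice[OF h] slice[OF k] bound[OF that]
    by (simp add: blinfun.add_right blinfun.diff_right blinfun.diff_left)
  show "norm (h - k) \<le> d + 2 * \<alpha>"
  proof (rule norm_blinfun_bound)
    show "0 \<le> d + 2 * \<alpha>"
      using d \<alpha> by simp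
    fix y
    \<comment> \<open>\<open>sgn y\<close> has norm at most 1 even for \<open>y = 0\<close>, where
      it is 0.\<close>
    have "blinfun_apply (h - k) (sgn y) \<le> d + 2 * \<alpha>" "- blinfun_apply (h - k) (sgn y) \<le> d + 2 * \<alpha>"
      using unit[of "sgn y"] unit[of "- sgn y"] by (simp_all add: norm_sgn blinfun.minus_right)
    then have "norm (blinfun_apply (h - k) (sgn y)) * norm y \<le> (d + 2 * \<alpha>) * norm y"
      by (intro mult_right_mono) auto
    moreover have "blinfun_apply (h - k) y = norm y * blinfun_apply (h - k) (sgn y)"
      by (cases "y = 0") (simp_all add: sgn_div_norm blinfun.scaleR_right)
    ultimately show "norm (blinfun_apply (h - k) y) \<le> (d + 2 * \<alpha>) * norm y"
      by (simp add: abs_mult mult.commute)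
  qed
qed

section \<open>Extension of functionals to the completion\<close>

lemma blinfun_extend_completion:
  fixes f :: "'a::real_normed_vector \<Rightarrow>\<^sub>L real"
  obtains g :: "'a completion \<Rightarrow>\<^sub>L real"
  where "\<And>x. blinfun_apply g (to_completion x) = blinfun_apply f x" "norm g \<le> norm f"
proof -
  define F where "F z = lim (\<lambda>n. blinfun_apply f (rep_completion z n))" for z
  have rep: "(\<lambda>n. to_completion (rep_completion z n)) \<longlonglongrightarrow> z" "Cauchy (rep_completion z)" for z :: "'a completion"
  proof -
    have "completion_rel (rep_completion z) (rep_completion z)"
      using Quotient_rep_reflp[OF Quotient_completion] .
    then show "Cauchy (rep_completion z)"
      by (simp add: completion_rel_def)
    then show "(\<lambda>n. to_completion (rep_completion z n)) \<longlonglongrightarrow> z"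
      using to_completion_tendsto Quotient_abs_rep[OF Quotient_completion] by metis
  qed
  \<comment> \<open>Every sequence whose image tends to \<open>z\<close> computes
    \<open>F z\<close>, because \<open>to_completion\<close> preserves norms. Linearity can thus be
    tested on sums and multiples of representatives.\<close>
  have F_lim: "(\<lambda>n. blinfun_apply f (X n)) \<longlonglongrightarrow> F z"
    if X: "(\<lambda>n. to_completion (X n)) \<longlonglongrightarrow> z" for X z
  proof -
    have "Cauchy (\<lambda>n. blinfun_apply f (rep_completion z n))"
      by (rule bounded_linear.Cauchy[OF blinfun.bounded_linear_right rep(2)])
    then have lim: "(\<lambda>n. blinfun_apply f (rep_completion z n)) \<longlonglongrightarrow> F z"
      by (simp add: F_def Cauchy_convergent_iff convergent_LIMSEQ_iff)
    have "(\<lambda>n. to_completion (X n) - to_completion (rep_completion z n)) \<longlonglongrightarrow> 0"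
      using tendsto_diff[OF X rep(1)[of z]] by simp
    then have "(\<lambda>n. norm (X n - rep_completion z n)) \<longlonglongrightarrow> 0"
      by (auto dest: tendsto_norm_zero simp flip: linear_diff[OF linear_to_completion])
    then have "(\<lambda>n. X n - rep_completion z n) \<longlonglongrightarrow> 0"
      by (rule tendsto_norm_zero_cancel)
    from tendsto_add[OF blinfun.tendsto[OF tendsto_const this, of f] lim] show ?thesis
      by (simp add: blinfun.diff_right)
  qed
  have F_bound: "norm (F z) \<le> norm z * norm f" for z
  proof (rule LIMSEQ_le)
    show "(\<lambda>n. norm (blinfun_apply f (rep_completion z n))) \<longlonglongrightarrow> norm (F z)"
      by (intro tendsto_norm F_lim rep)
    show "(\<lambda>n. norm (to_completion (rep_completion z n)) * norm f) \<longlonglongrightarrow> norm z * norm f"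
      by (intro tendsto_intros rep)
    show "\<exists>N. \<forall>n\<ge>N. norm (blinfun_apply f (rep_completion z n))
        \<le> norm (to_completion (rep_completion z n)) * norm f"
      using norm_blinfun[of f] by (metis mult.commute norm_to_completion)
  qed
  have lin: "bounded_linear F"
  proof (rule bounded_linear_intro[OF _ _ F_bound])
    fix y z :: "'a completion" and r :: real
    have "(\<lambda>n. to_completion (rep_completion y n + rep_completion z n)) \<longlonglongrightarrow> y + z"
      using tendsto_add[OF rep(1) rep(1), of y z] by (simp add: linear_add[OF linear_to_completion])
    from F_lim[OF this]
    have "(\<lambda>n. blinfun_apply f (rep_completion y n) + blinfun_apply f (rep_completion z n)) \<longlonglongrightarrow> F (y + z)"
      by (simp add: blinfun.add_right)
    from LIMSEQ_unique[OF this tendsto_add[OF F_lim[OF rep(1)] F_lim[OF rep(1)]]]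
    show "F (y + z) = F y + F z" .
    have "(\<lambda>n. to_completion (r *\<^sub>R rep_completion z n)) \<longlonglongrightarrow> r *\<^sub>R z"
      using tendsto_scaleR[OF tendsto_const rep(1)] by (simp add: linear_scale[OF linear_to_completion])
    from F_lim[OF this] have "(\<lambda>n. r *\<^sub>R blinfun_apply f (rep_completion z n)) \<longlonglongrightarrow> F (r *\<^sub>R z)"
      by (simp add: blinfun.scaleR_right)
    from LIMSEQ_unique[OF this tendsto_scaleR[OF tendsto_const F_lim[OF rep(1)]]]
    show "F (r *\<^sub>R z) = r *\<^sub>R F z" .
  qed
  show ?thesis
  proof
    show "blinfun_apply (Blinfun F) (to_completion x) = blinfun_apply f x" for x
      using LIMSEQ_unique[OF F_lim[of "\<lambda>_. x"]] by (simp add: bounded_linear_Blinfun_apply[OF lin])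
    show "norm (Blinfun F) \<le> norm f"
      using F_bound by (intro norm_blinfun_bound)
        (simp_all add: bounded_linear_Blinfun_apply[OF lin] mult.commute)
  qed
qed

section \<open>The norm of \<open>JH\<^sub>\<infinity>\<close> on finitely nonzero functions\<close>

lemma admissible_sum_le_norm:
  assumes "admissible \<S>"
  shows "(\<Sum>S\<in>\<S>. \<bar>\<Sum>t\<in>S. Rep_jh_fin y t\<bar>) \<le> norm y"
  unfolding norm_jh_fin.rep_eq using assms Rep_jh_fin[of y]
  by (intro cSUP_upper jh_bdd_above) auto

lemma norm_jh_fin_leI:
  assumes "\<And>\<S>. admissible \<S> \<Longrightarrow> (\<Sum>S\<in>\<S>. \<bar>\<Sum>t\<in>S. Rep_jh_fin y t\<bar>) \<le> c"
  shows "norm y \<le> c"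
  unfolding norm_jh_fin.rep_eq using assms admissible_singleton by (intro cSUP_least) auto

lemma abs_Rep_jh_fin_le_norm: "\<bar>Rep_jh_fin y t\<bar> \<le> norm y"
  using admissible_sum_le_norm[OF admissible_singleton[of t], of y] by simp

section \<open>Sums along initial segments\<close>

text \<open>Initial segments are the only segments containing the root, hence the only ones on which
  the root vector acts.\<close>

definition branch_sum :: "jh_fin \<Rightarrow> nat list \<Rightarrow> real"
  where "branch_sum y b = (\<Sum>t | prefix t b. Rep_jh_fin y t)"

lemma finite_prefixes [simp]: "finite {t. prefix t b}"
proof -
  have "{t. prefix t b} = set (prefixes b)"
    by auto
  then show ?thesis
    by simp
qed

lemma admissible_initial: "admissible {{t. prefix t b}}"
proof -
  have "nm_segment 0 (length b) {t. prefix t b}"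
    unfolding nm_segment_def by (rule exI[of _ "[]"], rule exI[of _ b]) simp
  then show ?thesis
    by (auto simp: admissible_def)
qed

lemma abs_branch_sum_le_norm: "\<bar>branch_sum y b\<bar> \<le> norm y"
  using admissible_sum_le_norm[OF admissible_initial[of b], of y] by (simp add: branch_sum_def)

text \<open>All members start at one level. If one contains the root, that level is 0, so all
  contain it, and disjointness leaves a single member.\<close>

lemma admissible_cases:
  assumes "admissible \<S>"
  obtains b where "\<S> = {{t. prefix t b}}" | "\<And>S. S \<in> \<S> \<Longrightarrow> [] \<notin> S"
proof (cases "\<exists>S\<in>\<S>. [] \<in> S")
  case True
  then obtain S where S: "S \<in> \<S>" "[] \<in> S"
    by blast
  obtain n m where nm: "\<forall>S\<in>\<S>. nm_segment n m S" and disj: "pairwise disjnt \<S>"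
    using assms by (auto simp: admissible_def)
  have "n = 0"
    using nm S by (fastforce simp: nm_segment_def)
  then have init: "\<exists>b. S' = {t. prefix t b}" if "S' \<in> \<S>" for S'
    using nm that by (fastforce simp: nm_segment_def)
  have "S' = S" if "S' \<in> \<S>" for S'
  proof (rule ccontr)
    assume "S' \<noteq> S"
    then have "S' \<inter> S = {}"
      using disj S that by (auto simp: pairwise_def disjnt_def)
    moreover have "[] \<in> S'"
      using init[OF that] by auto
    ultimately show False
      using S by blast
  qed
  then have "\<S> = {S}"
    using S by blast
  then show ?thesis
    using init[OF S(1)] that(1) by blast
qed (use that(2) in blast)

text \<open>Some number \<open>v\<close> occurs in no node of the finite support. Appending copies
  of \<open>v\<close> to \<open>a\<close> therefore adds only nodes where \<open>y\<close>
  vanishes.\<close>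

lemma branch_sum_prolong:
  assumes "length a \<le> m"
  obtains a' where "length a' = m" "branch_sum y a' = branch_sum y a"
proof -
  have "finite (\<Union>t\<in>{t. Rep_jh_fin y t \<noteq> 0}. set t)"
    using Rep_jh_fin[of y] by auto
  then obtain v where v: "v \<notin> (\<Union>t\<in>{t. Rep_jh_fin y t \<noteq> 0}. set t)"
    using ex_new_if_finite infinite_UNIV_nat by blast
  define a' where "a' = a @ replicate (m - length a) v"
  have "Rep_jh_fin y t = 0" if t: "prefix t a'" "\<not> prefix t a" for t
  proof -
    obtain us where us: "t = a @ us" "prefix us (replicate (m - length a) v)"
      using t by (auto simp: a'_def prefix_append)
    with t(2) have "us \<noteq> []"
      by auto
    moreover have "set us \<subseteq> {v}"
      using set_mono_prefix[OF us(2)] by (auto split: if_splits)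
    ultimately have "v \<in> set t"
      using us(1) by (cases us) auto
    then show ?thesis
      using v by blast
  qed
  moreover have "prefix a a'"
    by (simp add: a'_def)
  ultimately have "branch_sum y a' = branch_sum y a"
    unfolding branch_sum_def by (intro sum.mono_neutral_right) auto
  then show ?thesis
    using that[of a'] assms by (simp add: a'_def)
qed

lemma branch_sum_append:
  "branch_sum y (c @ x # xs) = branch_sum y c
    + (\<Sum>t | prefix (c @ [x]) t \<and> prefix t (c @ x # xs). Rep_jh_fin y t)"
proof -
  have "{t. prefix t (c @ x # xs)}
      = {t. prefix t c} \<union> {t. prefix (c @ [x]) t \<and> prefix t (c @ x # xs)}"
    by (auto simp: prefix_append prefix_Cons)
  moreover have "{t. prefix t c} \<inter> {t. prefix (c @ [x]) t \<and> prefix t (c @ x # xs)} = {}"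
    by (auto simp: prefix_def)
  ultimately show ?thesis
    unfolding branch_sum_def by (metis sum.union_disjoint finite_prefixes finite_Collect_conjI)
qed

text \<open>The common prefix \<open>c\<close> cancels in the difference. The two remainders are
  disjoint segments from level \<open>Suc (length c)\<close> to the common end level, hence an
  admissible pair.\<close>

lemma branch_sum_diff_le_norm_same_length:
  assumes "length a = length b"
  shows "\<bar>branch_sum y a - branch_sum y b\<bar> \<le> norm y"
proof (cases "a = b")
  case False
  with assms have "a \<parallel> b"
    by (metis not_equal_is_parallel)
  then obtain c x xs z zs where a: "a = c @ x # xs" and b: "b = c @ z # zs" and "x \<noteq> z"
    using parallel_decomp by blast
  define A where "A = {t. prefix (c @ [x]) t \<and> prefix t a}"
  define B where "B = {t. prefix (c @ [z]) t \<and> prefix t b}"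
  have disj: "A \<inter> B = {}"
    using \<open>x \<noteq> z\<close> by (auto simp: A_def B_def a b prefix_def)
  \<comment> \<open>Disjointness alone would allow both sets to be empty; distinctness makes the sum
    over \<open>{A, B}\<close> have two terms.\<close>
  moreover have "c @ [x] \<in> A"
    by (auto simp: A_def a)
  ultimately have "A \<noteq> B"
    by blast
  have "nm_segment (Suc (length c)) (length a) A"
    unfolding nm_segment_def A_def
    by (rule exI[of _ "c @ [x]"], rule exI[of _ a]) (simp add: a)
  moreover have "nm_segment (Suc (length c)) (length a) B"
    unfolding nm_segment_def B_def
    by (rule exI[of _ "c @ [z]"], rule exI[of _ b]) (use assms in \<open>simp add: a b\<close>)
  moreover have "Suc (length c) \<le> length a"
    by (simp add: a)
  ultimately have "admissible {A, B}"
    using disj unfolding admissible_def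
    by (intro conjI exI[of _ "Suc (length c)"] exI[of _ "length a"])
      (auto simp: pairwise_def disjnt_def)
  from admissible_sum_le_norm[OF this, of y] \<open>A \<noteq> B\<close> show ?thesis
    using branch_sum_append[of y c x xs] branch_sum_append[of y c z zs]
    by (simp add: a b A_def B_def)
qed simp

lemma branch_sum_diff_le_norm: "\<bar>branch_sum y a - branch_sum y b\<bar> \<le> norm y"
proof -
  obtain a' where a': "length a' = max (length a) (length b)" "branch_sum y a' = branch_sum y a"
    by (rule branch_sum_prolong[OF max.cobounded1])
  obtain b' where b': "length b' = max (length a) (length b)" "branch_sum y b' = branch_sum y b"
    by (rule branch_sum_prolong[OF max.cobounded2])
  show ?thesis
    using branch_sum_diff_le_norm_same_length[of a' b' y] a' b' by simp
qed

section \<open>The unit vector at the root\<close>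

lift_definition root_vec :: jh_fin is "\<lambda>t. if t = [] then 1 else 0"
  by simp

lemma branch_sum_root_vec_plus: "branch_sum (root_vec + y) b = 1 + branch_sum y b"
  by (simp add: branch_sum_def plus_jh_fin.rep_eq root_vec.rep_eq sum.distrib sum.delta)

text \<open>Which case holds depends on the family alone, so \<open>y\<close> may be instantiated
  afterwards, in particular with a negative.\<close>

lemma admissible_sum_root_vec_cases:
  assumes "admissible \<S>"
  shows "(\<exists>b. \<forall>y. (\<Sum>S\<in>\<S>. \<bar>\<Sum>t\<in>S. Rep_jh_fin (root_vec + y) t\<bar>) = \<bar>1 + branch_sum y b\<bar>)
    \<or> (\<forall>y. (\<Sum>S\<in>\<S>. \<bar>\<Sum>t\<in>S. Rep_jh_fin (root_vec + y) t\<bar>) \<le> norm y)"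
  using assms
proof (cases rule: admissible_cases)
  case (1 b)
  then show ?thesis
    by (intro disjI1 exI[of _ b] allI)
      (simp flip: branch_sum_root_vec_plus, simp add: branch_sum_def)
next
  case 2
  have "(\<Sum>S\<in>\<S>. \<bar>\<Sum>t\<in>S. Rep_jh_fin (root_vec + y) t\<bar>) = (\<Sum>S\<in>\<S>. \<bar>\<Sum>t\<in>S. Rep_jh_fin y t\<bar>)" for y
    using 2 by (intro sum.cong refl arg_cong[of _ _ abs])
      (auto simp: plus_jh_fin.rep_eq root_vec.rep_eq)
  then show ?thesis
    using admissible_sum_le_norm[OF assms] by simp
qed

text \<open>For \<open>norm y \<le> 1\<close> the bound is \<open>2 + norm y\<close>; the maximum makes the inequality hold for
  all \<open>y\<close>, so that it passes to the completion by density.\<close>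

lemma norm_root_vec_plus_minus:
  "norm (root_vec + y) + norm (root_vec - y) \<le> max (2 + norm y) (1 + 2 * norm y)"
    (is "_ \<le> ?c")
proof -
  let ?\<sigma> = "\<lambda>\<S> y. \<Sum>S\<in>\<S>. \<bar>\<Sum>t\<in>S. Rep_jh_fin (root_vec + y) t\<bar>"
  have neg: "branch_sum (- y) b = - branch_sum y b" for b
    by (simp add: branch_sum_def uminus_jh_fin.rep_eq sum_negf)
  have pair: "?\<sigma> \<S> y + ?\<sigma> \<S>' (- y) \<le> ?c" if "admissible \<S>" "admissible \<S>'" for \<S> \<S>'
    using admissible_sum_root_vec_cases[OF that(1)]
  proof (elim disjE exE)
    fix b assume b: "\<forall>y. ?\<sigma> \<S> y = \<bar>1 + branch_sum y b\<bar>"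
    show ?thesis
      using admissible_sum_root_vec_cases[OF that(2)]
    proof (elim disjE exE)
      fix b' assume b': "\<forall>y. ?\<sigma> \<S>' y = \<bar>1 + branch_sum y b'\<bar>"
      \<comment> \<open>Write \<open>s\<close>, \<open>s'\<close> for the branch sums and
        \<open>r\<close> for \<open>norm y\<close>. If \<open>1 + s\<close> and
        \<open>1 - s'\<close> are nonnegative, the sum is \<open>2 + (s - s') \<le> 2 + r\<close>;
        opposite signs give at most \<open>2 * r\<close>, two negative signs at most
        \<open>r - 2\<close>.\<close>
      show ?thesis
        unfolding b[rule_format] b'[rule_format] neg
        using abs_branch_sum_le_norm[of y b] abs_branch_sum_le_norm[of y b']
          branch_sum_diff_le_norm[of y b b'] by linarith
    next
      \<comment> \<open>Only one family meets the root: this is the source of the term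
        \<open>1 + 2 * norm y\<close>.\<close>
      assume "\<forall>y. ?\<sigma> \<S>' y \<le> norm y"
      from this[rule_format, of "- y"] show ?thesis
        unfolding b[rule_format] norm_minus_cancel
        using abs_branch_sum_le_norm[of y b] by linarith
    qed
  next
    assume s: "\<forall>y. ?\<sigma> \<S> y \<le> norm y"
    show ?thesis
      using admissible_sum_root_vec_cases[OF that(2)]
    proof (elim disjE exE)
      fix b' assume b': "\<forall>y. ?\<sigma> \<S>' y = \<bar>1 + branch_sum y b'\<bar>"
      show ?thesis
        unfolding b'[rule_format] neg
        using s[rule_format, of y] abs_branch_sum_le_norm[of y b'] by linarith
    next
      assume "\<forall>y. ?\<sigma> \<S>' y \<le> norm y"
      from this[rule_format, of "- y"] s[rule_format, of y] show ?thesis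
        by simp
    qed
  qed
  \<comment> \<open>The two suprema are taken in turn, first over \<open>\<S>\<close> with
    \<open>\<S>'\<close> fixed, then over \<open>\<S>'\<close>.\<close>
  have "norm (root_vec + y) \<le> ?c - ?\<sigma> \<S>' (- y)" if "admissible \<S>'" for \<S>'
    using pair[OF _ that] by (intro norm_jh_fin_leI) (simp add: le_diff_eq)
  then have "norm (root_vec + - y) \<le> ?c - norm (root_vec + y)"
    by (intro norm_jh_fin_leI) (simp add: le_diff_eq add.commute)
  then show ?thesis
    by simp
qed

lemma norm_root_vec: "norm root_vec = 1"
proof (rule antisym)
  show "norm root_vec \<le> 1"
    \<comment> \<open>At \<open>y = 0\<close> the inequality reads
      \<open>2 * norm root_vec \<le> 2\<close>.\<close>
    using norm_root_vec_plus_minus[of 0] by simp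
  show "1 \<le> norm root_vec"
    using abs_Rep_jh_fin_le_norm[of root_vec "[]"] by (simp add: root_vec.rep_eq)
qed

section \<open>Passage to the completion and the slice estimate\<close>

lemma norm_completion_root_vec_plus_minus:
  "norm (to_completion root_vec + y) + norm (to_completion root_vec - y)
    \<le> max (2 + norm y) (1 + 2 * norm y)"
proof -
  let ?C = "{y. norm (to_completion root_vec + y) + norm (to_completion root_vec - y)
    \<le> max (2 + norm y) (1 + 2 * norm y)}"
  have "closed ?C"
    by (intro closed_Collect_le continuous_intros)
  moreover have "range to_completion \<subseteq> ?C"
    using norm_root_vec_plus_minus
    by (auto simp flip: linear_add[OF linear_to_completion] linear_diff[OF linear_to_completion])
  ultimately have "closure (range to_completion) \<subseteq> ?C"
    by (simp add: closure_minimal)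
  then show ?thesis
    by (auto simp: closure_range_to_completion)
qed

text \<open>Evaluation at the root has norm at most 1, since the singleton of the root is an
  admissible family; it extends to the completion.\<close>

lemma root_functional:
  obtains g :: "JH_infty \<Rightarrow>\<^sub>L real" where "norm g \<le> 1" "blinfun_apply g (to_completion root_vec) = 1"
proof -
  have lin: "bounded_linear (\<lambda>y. Rep_jh_fin y [])"
    by (rule bounded_linear_intro[of _ 1])
      (simp_all add: plus_jh_fin.rep_eq scaleR_jh_fin.rep_eq abs_Rep_jh_fin_le_norm)
  obtain g :: "JH_infty \<Rightarrow>\<^sub>L real"
    where g: "\<And>x. blinfun_apply g (to_completion x) = blinfun_apply (Blinfun (\<lambda>y. Rep_jh_fin y [])) x"
      and "norm g \<le> norm (Blinfun (\<lambda>y. Rep_jh_fin y []))"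
    using blinfun_extend_completion by blast
  moreover have "norm (Blinfun (\<lambda>y. Rep_jh_fin y [])) \<le> 1"
    by (rule norm_blinfun_bound)
      (simp_all add: bounded_linear_Blinfun_apply[OF lin] abs_Rep_jh_fin_le_norm)
  ultimately show ?thesis
    by (intro that[of g]) (simp_all add: bounded_linear_Blinfun_apply[OF lin] root_vec.rep_eq)
qed

theorem theorem4p3:
  shows "\<exists>x :: JH_infty. norm x = 1 \<and>
    (INF \<alpha>\<in>{0 <..}. diameter (wstar_slice (cball (0 :: JH_infty \<Rightarrow>\<^sub>L real) 1) x \<alpha>)) \<le> 5 / 3"
proof (intro exI conjI)
  let ?x = "to_completion root_vec"
  show "norm ?x = 1"
    by (simp add: norm_root_vec)
  obtain g :: "JH_infty \<Rightarrow>\<^sub>L real" where g: "norm g \<le> 1" "blinfun_apply g ?x = 1"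
    by (rule root_functional)
  \<comment> \<open>Boundedness makes the diameters nonnegative, so the real infimum is over a set
    bounded below.\<close>
  have bounded: "bounded (wstar_slice (cball (0 :: JH_infty \<Rightarrow>\<^sub>L real) 1) ?x \<alpha>)" for \<alpha>
    by (rule bounded_subset[OF bounded_cball[of 0 1]]) (auto simp: wstar_slice_def)
  have "norm (?x + y) + norm (?x - y) \<le> 2 + 1" if "norm y \<le> 1" for y
    using norm_completion_root_vec_plus_minus[of y] that by simp
  \<comment> \<open>With \<open>d = 1\<close>, the width \<open>1/3\<close> gives exactly
    \<open>1 + 2/3 = 5/3\<close>.\<close>
  from diameter_wstar_slice_le[OF this g, of "1/3"]
  have "diameter (wstar_slice (cball (0 :: JH_infty \<Rightarrow>\<^sub>L real) 1) ?x (1/3)) \<le> 5/3"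
    by simp
  then show "(INF \<alpha>\<in>{0 <..}. diameter (wstar_slice (cball (0 :: JH_infty \<Rightarrow>\<^sub>L real) 1) ?x \<alpha>)) \<le> 5 / 3"
    by (intro cINF_lower2[where x="1/3"] bdd_belowI2[where m=0] diameter_ge_0 bounded) auto
qed

end
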